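(* Let $k\geq 4$ be an integer and let $A$ be a finite set of $k$ positive integers. Then $$|3\hat{}_{\underline{+}}A| \geq 6k-8.$$ Moreover, if $|3\hat{}_{\underline{+}}A|=6k-8$, then $A=d*\{1,3,5,\ldots,2k-1\}$ for some positive integer $d$.
   Context: For a finite set $A=\{a_0,a_1,\ldots,a_{k-1}\}$ of $k$ distinct integers and an integer $1\leq h\leq k$, the $h$-fold restricted signed sumset of $A$ is $$h\hat{}_{\underline{+}}A:=\Big\{\sum_{i=0}^{k-1}\lambda_i a_i : (\lambda_0,\ldots,\lambda_{k-1})\in\{-1,0,1\}^k,\ \sum_{i=0}^{k-1}|\lambda_i|=h\Big\}.$$ $|S|$ denotes the cardinality of a finite set $S$. For an integer $d$ and a set $S$ of integers, $d*S=\{d\cdot s : s\in S\}$ is the $d$-dilation of $S$. The set $\{1,3,5,\ldots,2k-1\}$ consists of the first $k$ odd positive integers. *)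

theory Defs
  imports Main
begin

text \<open>
  As the elements of \<open>A\<close> are distinct, the coefficient vector is indexed by the elements of \<open>A\<close>
  themselves: \<open>c a\<close> is the coefficient of \<open>a\<close>.  The values of \<open>c\<close> outside \<open>A\<close> are irrelevant.
\<close>

definition restricted_signed_sumset :: "nat \<Rightarrow> int set \<Rightarrow> int set" where
  "restricted_signed_sumset h A =
     {\<Sum>a\<in>A. c a * a | c :: int \<Rightarrow> int.
        (\<forall>a\<in>A. c a \<in> {-1, 0, 1}) \<and> (\<Sum>a\<in>A. \<bar>c a\<bar>) = int h}"

definition dilation :: "int \<Rightarrow> int set \<Rightarrow> int set" where
  "dilation d S = (\<lambda>s. d * s) ` S"

definition first_odds :: "nat \<Rightarrow> int set" where
  "first_odds k = {2 * int i - 1 | i. 1 \<le> i \<and> i \<le> k}"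

end

theory Submission
  imports Defs
begin

text \<open>
  The proof is by induction on the size of \<open>A\<close>.  Let \<open>x > p > q > r\<close> be the four largest elements
  of \<open>A\<close> and let \<open>B = A - {x}\<close>.  Every signed sum of three elements of \<open>B\<close> has absolute value at
  most \<open>p + q + r\<close>, and \<open>x + q + r < x + p + r < x + p + q\<close> all exceed this bound.  With their
  negatives they are six new sums (\<open>insert_larger_element\<close>), so the bound grows by 6 at each step.

  If the final count is exactly \<open>6 * k - 8\<close>, then each step adds exactly six sums.  By induction
  \<open>B\<close> is \<open>d\<close> times the odd numbers \<open>1, 3, \<dots>\<close>, and only the new largest element \<open>x\<close> has to be
  found (\<open>extremal_new_element\<close>).  Let \<open>s\<close> be the fourth largest element of \<open>B\<close>.  The sum
  \<open>x + q + s\<close> is positive and smaller than the three new positive sums, so it is a sum of elements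
  of \<open>B\<close>.  Hence it is at most \<open>p + q + r\<close> and an odd multiple of \<open>d\<close>.  The first property bounds
  \<open>x\<close> from above, the second restricts it to odd multiples of \<open>d\<close>, and together with \<open>p < x\<close> they
  leave only the next odd multiple of \<open>d\<close> after \<open>p\<close>.

  What remains is the case of four elements \<open>a < b < c < d\<close> (\<open>four_elements\<close>).  The set of sums is
  symmetric about 0, so nine distinct nonnegative sums make at least 17 sums in total, and this holds
  even if one of the nine is 0.  Such nine sums are exhibited for every quadruple other than
  \<open>a, 3 * a, 5 * a, 7 * a\<close>, which has 16 sums.  Most of the nine are of the form \<open>d\<close> plus a signed
  sum of two of \<open>a, b, c\<close>.  These can coincide only if some linear relation holds between \<open>a\<close>,
  \<open>b\<close> and \<open>c\<close>, and the case distinction follows these relations; the decisive one is whether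
  \<open>a, b, c\<close> is an arithmetic progression.
\<close>

section \<open>Signed sums of three elements\<close>

text \<open>The support of a coefficient vector of weight 3 has exactly three elements.\<close>

lemma restricted_signed_sumset_3_iff:
  assumes "finite A"
  shows "v \<in> restricted_signed_sumset 3 A \<longleftrightarrow>
    (\<exists>x y z s t u. {x, y, z} \<subseteq> A \<and> x \<noteq> y \<and> x \<noteq> z \<and> y \<noteq> z \<and>
       {s, t, u} \<subseteq> {-1, 1} \<and> v = s * x + t * y + u * z)" (is "_ \<longleftrightarrow> ?R")
proof
  assume "v \<in> restricted_signed_sumset 3 A"
  then obtain f where f: "\<forall>a\<in>A. f a \<in> {-1, 0, 1}" "(\<Sum>a\<in>A. \<bar>f a\<bar>) = 3"
    and v: "v = (\<Sum>a\<in>A. f a * a)"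
    unfolding restricted_signed_sumset_def by auto
  define B where "B = {a \<in> A. f a \<noteq> 0}"
  have "(\<Sum>a\<in>A. \<bar>f a\<bar>) = (\<Sum>a\<in>B. \<bar>f a\<bar>)"
    unfolding B_def using assms by (intro sum.mono_neutral_right) auto
  also have "\<dots> = (\<Sum>a\<in>B. 1)"
    unfolding B_def using f(1) by (intro sum.cong) auto
  finally have "card B = 3"
    using f(2) by simp
  then obtain x y z where B: "B = {x, y, z}" and ne: "x \<noteq> y" "x \<noteq> z" "y \<noteq> z"
    by (auto simp: card_3_iff)
  have "v = (\<Sum>a\<in>B. f a * a)"
    unfolding v B_def using assms by (intro sum.mono_neutral_right) auto
  also have "\<dots> = f x * x + f y * y + f z * z"
    using ne by (simp add: B)
  finally have v3: "v = f x * x + f y * y + f z * z" .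
  have mem: "a \<in> A \<and> f a \<in> {-1, 1}" if "a \<in> {x, y, z}" for a
    using that f(1) unfolding B[symmetric] B_def by auto
  show ?R
    by (rule exI[of _ x], rule exI[of _ y], rule exI[of _ z], rule exI[of _ "f x"],
        rule exI[of _ "f y"], rule exI[of _ "f z"]) (use ne v3 mem in simp)
next
  assume ?R
  then obtain x y z s t u where A: "{x, y, z} \<subseteq> A" and ne: "x \<noteq> y" "x \<noteq> z" "y \<noteq> z"
    and st: "{s, t, u} \<subseteq> {-1, 1}" and v: "v = s * x + t * y + u * z"
    by (elim exE conjE)
  define f where "f a = (if a = x then s else if a = y then t else if a = z then u else 0)" for a
  have "(\<Sum>a\<in>A. f a * a) = (\<Sum>a\<in>{x, y, z}. f a * a)"
    using assms A by (intro sum.mono_neutral_right) (auto simp: f_def)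
  also have "\<dots> = v"
    using ne by (simp add: v f_def)
  finally have "v = (\<Sum>a\<in>A. f a * a)" ..
  moreover have "(\<Sum>a\<in>A. \<bar>f a\<bar>) = (\<Sum>a\<in>{x, y, z}. \<bar>f a\<bar>)"
    using assms A by (intro sum.mono_neutral_right) (auto simp: f_def)
  then have "(\<Sum>a\<in>A. \<bar>f a\<bar>) = int 3"
    using ne st by (auto simp: f_def)
  moreover have "\<forall>a\<in>A. f a \<in> {-1, 0, 1}"
    using st by (auto simp: f_def)
  ultimately show "v \<in> restricted_signed_sumset 3 A"
    unfolding restricted_signed_sumset_def by blast
qed

lemma restricted_signed_sumset_3E:
  assumes "finite A" "v \<in> restricted_signed_sumset 3 A"
  obtains x y z s t u where "{x, y, z} \<subseteq> A" "x \<noteq> y" "x \<noteq> z" "y \<noteq> z"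
    "{s, t, u} \<subseteq> {-1, 1}" "v = s * x + t * y + u * z"
  using assms(2) unfolding restricted_signed_sumset_3_iff[OF assms(1)] by (elim exE conjE)

lemma signed_triple_mem:
  assumes "finite A" "x \<in> A" "y \<in> A" "z \<in> A" "x \<noteq> y" "x \<noteq> z" "y \<noteq> z"
    and "s \<in> {-1, 1}" "t \<in> {-1, 1}" "u \<in> {-1, 1}"
  shows "s * x + t * y + u * z \<in> restricted_signed_sumset 3 A"
  unfolding restricted_signed_sumset_3_iff[OF assms(1)]
  by (rule exI[of _ x], rule exI[of _ y], rule exI[of _ z], rule exI[of _ s], rule exI[of _ t],
      rule exI[of _ u]) (use assms in simp)

text \<open>
  The sums are listed with the larger elements first, in the syntactic form in which they appear in
  the lists of distinct sums for four elements.
\<close>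

lemma signed_triples_mem:
  assumes "finite A" "x \<in> A" "y \<in> A" "z \<in> A" "x < y" "y < z"
  shows "z + y + x \<in> restricted_signed_sumset 3 A" "z + y - x \<in> restricted_signed_sumset 3 A"
    "z - y + x \<in> restricted_signed_sumset 3 A" "z - y - x \<in> restricted_signed_sumset 3 A"
    "- z + y + x \<in> restricted_signed_sumset 3 A"
  using signed_triple_mem[of A z y x 1 1 1] signed_triple_mem[of A z y x 1 1 "-1"]
    signed_triple_mem[of A z y x 1 "-1" 1] signed_triple_mem[of A z y x 1 "-1" "-1"]
    signed_triple_mem[of A z y x "-1" 1 1] assms by auto

lemma restricted_signed_sumset_3_mono:
  assumes "finite B" "A \<subseteq> B"
  shows "restricted_signed_sumset 3 A \<subseteq> restricted_signed_sumset 3 B"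
proof
  fix v assume "v \<in> restricted_signed_sumset 3 A"
  then obtain x y z s t u where "{x, y, z} \<subseteq> A" "x \<noteq> y" "x \<noteq> z" "y \<noteq> z"
    "{s, t, u} \<subseteq> {-1, 1}" "v = s * x + t * y + u * z"
    by (rule restricted_signed_sumset_3E[OF finite_subset[OF assms(2,1)]])
  then show "v \<in> restricted_signed_sumset 3 B"
    using assms signed_triple_mem[of B x y z s t u] by auto
qed

lemma uminus_mem_restricted_signed_sumset:
  assumes "v \<in> restricted_signed_sumset h A"
  shows "- v \<in> restricted_signed_sumset h A"
proof -
  obtain f where f: "\<forall>a\<in>A. f a \<in> {-1, 0, 1}" "(\<Sum>a\<in>A. \<bar>f a\<bar>) = int h"
    and v: "v = (\<Sum>a\<in>A. f a * a)"
    using assms unfolding restricted_signed_sumset_def by auto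
  have "- v = (\<Sum>a\<in>A. (- f a) * a)"
    by (simp add: v sum_negf)
  moreover have "\<forall>a\<in>A. - f a \<in> {-1, 0, 1}" "(\<Sum>a\<in>A. \<bar>- f a\<bar>) = int h"
    using f by auto
  ultimately show ?thesis
    unfolding restricted_signed_sumset_def by (intro CollectI exI[of _ "\<lambda>a. - f a"]) simp
qed

lemma finite_restricted_signed_sumset_3:
  assumes "finite A"
  shows "finite (restricted_signed_sumset 3 A)"
proof -
  let ?f = "\<lambda>(s, t, u, x, y, z). s * x + t * y + u * z :: int"
  let ?E = "{-1, 1} :: int set"
  have "v \<in> ?f ` (?E \<times> ?E \<times> ?E \<times> A \<times> A \<times> A)" if mem: "v \<in> restricted_signed_sumset 3 A" for v
  proof -
    obtain x y z s t u where "{x, y, z} \<subseteq> A" "{s, t, u} \<subseteq> ?E" "v = s * x + t * y + u * z"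
      by (rule restricted_signed_sumset_3E[OF assms mem])
    then show ?thesis
      by (intro image_eqI[of _ _ "(s, t, u, x, y, z)"]) simp_all
  qed
  then have "restricted_signed_sumset 3 A \<subseteq> ?f ` (?E \<times> ?E \<times> ?E \<times> A \<times> A \<times> A)"
    by blast
  then show ?thesis
    by (rule finite_subset) (use assms in simp)
qed

text \<open>
  The set \<open>S\<close> contains \<open>T\<close> and its mirror image, and these can meet only in 0.
\<close>

lemma card_symmetric_ge:
  fixes S T :: "int set"
  assumes "finite S" "\<And>v. v \<in> S \<Longrightarrow> - v \<in> S" "T \<subseteq> S" "\<forall>v\<in>T. v \<ge> 0"
  shows "2 * card T \<le> card S + card (T \<inter> {0})"
proof -
  have fin: "finite T"
    using assms finite_subset by blast
  have "v = 0" if "v \<in> T" "- v \<in> T" for v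
    using assms(4) that by (metis neg_0_le_iff_le order_antisym)
  then have "T \<inter> uminus ` T = T \<inter> {0}"
    by force
  then have "2 * card T = card (T \<union> uminus ` T) + card (T \<inter> {0})"
    using card_Un_Int[of T "uminus ` T"] fin by (simp add: card_image)
  moreover have "card (T \<union> uminus ` T) \<le> card S"
    using assms by (intro card_mono) auto
  ultimately show ?thesis
    by simp
qed

lemma card_ge_of_nonneg_sums:
  assumes "finite A" "distinct vs" "set vs \<subseteq> restricted_signed_sumset 3 A"
    and "\<forall>v\<in>set vs. v \<ge> 0"
  shows "2 * length vs \<le> card (restricted_signed_sumset 3 A) + 1"
    and "0 \<notin> set vs \<Longrightarrow> 2 * length vs \<le> card (restricted_signed_sumset 3 A)"
proof -
  have *: "2 * card (set vs) \<le> card (restricted_signed_sumset 3 A) + card (set vs \<inter> {0})"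
    using assms finite_restricted_signed_sumset_3 uminus_mem_restricted_signed_sumset
    by (intro card_symmetric_ge) auto
  moreover have "card (set vs \<inter> {0}) \<le> card {0 :: int}"
    by (intro card_mono) auto
  ultimately show "2 * length vs \<le> card (restricted_signed_sumset 3 A) + 1"
    using assms(2) by (simp add: distinct_card)
  show "2 * length vs \<le> card (restricted_signed_sumset 3 A)" if "0 \<notin> set vs"
    using * that assms(2) by (simp add: distinct_card)
qed

section \<open>Four elements\<close>

lemma signed_sums_of_four:
  assumes "finite A" "{a, b, c, d} \<subseteq> A" "a < b" "b < c" "c < d"
  defines "S \<equiv> restricted_signed_sumset 3 A"
  shows "d + c + b \<in> S" "d + c - b \<in> S" "d - c + b \<in> S"
    "d + c + a \<in> S" "d + c - a \<in> S" "d - c + a \<in> S" "d - c - a \<in> S" "- d + c + a \<in> S"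
    "d + b + a \<in> S" "d + b - a \<in> S" "d - b + a \<in> S" "d - b - a \<in> S" "- d + b + a \<in> S"
    "c + b + a \<in> S" "c + b - a \<in> S" "c - b + a \<in> S" "c - b - a \<in> S" "- c + b + a \<in> S"
  using assms(2-5) signed_triples_mem[OF assms(1)] unfolding S_def by simp_all

text \<open>
  As \<open>0 < a < b < c\<close>, the numbers
  \<open>b + c > a + c > c - a > c - b > b - c > a - c\<close> form a strict chain, and \<open>b - a\<close> and \<open>a - b\<close> are two
  further values unless \<open>b - a = c - b\<close>.  Adding \<open>d\<close> gives eight positive sums when \<open>a, b, c\<close> is not
  a progression.  The ninth is \<open>c - b - a\<close> up to sign, or \<open>d + b + a\<close>, or \<open>c + b - a\<close> in a single
  exceptional family.  If \<open>c \<le> a + b\<close>, then \<open>- c + b + a\<close> works because it is less than \<open>d - c + a\<close>, the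
  least of the eight.
\<close>

lemma card_ge_17_if_no_progression:
  fixes a b c d :: int
  assumes "finite A" "{a, b, c, d} \<subseteq> A" "0 < a" "a < b" "b < c" "c < d"
    and "c \<noteq> 2 * b - a"
  shows "17 \<le> card (restricted_signed_sumset 3 A)"
proof -
  note mem = signed_sums_of_four[OF assms(1,2,4,5,6)]
  let ?T = "\<lambda>v. [d + c + b, d + c + a, d + c - a, d + c - b, d + b - a, d - b + a,
    d - c + b, d - c + a, v]"
  have *: ?thesis if "distinct (?T v)" "v \<in> restricted_signed_sumset 3 A" "v \<ge> 0" for v
  proof -
    have "set (?T v) \<subseteq> restricted_signed_sumset 3 A"
      using that(2) mem by simp
    moreover have "\<forall>y\<in>set (?T v). 0 \<le> y"
      using that(3) assms(3-) by simp
    ultimately show ?thesis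
      using card_ge_of_nonneg_sums(1)[OF assms(1) that(1)] by simp
  qed
  \<comment> \<open>\<open>d + b + a\<close> equals \<open>d + c - a\<close> if \<open>c = b + 2 * a\<close>, and \<open>d + c - b\<close> if \<open>c = 2 * b + a\<close>.  In the
    latter case \<open>c - b - a = b\<close>, which is \<open>d - c + a\<close> exactly when \<open>d = 3 * b\<close>.\<close>
  consider "c \<le> a + b" | "c > a + b" "c = b + 2 * a" | "c = 2 * b + a" "d \<noteq> 3 * b"
    | "c = 2 * b + a" "d = 3 * b" | "c \<noteq> b + 2 * a" "c \<noteq> 2 * b + a"
    by linarith
  then show ?thesis
  proof cases
    case 1
    show ?thesis
      by (rule *[of "- c + b + a"], use 1 assms(3-) in simp, fact mem, use 1 assms(3-) in simp)
  next
    case 2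
    show ?thesis
      by (rule *[of "c - b - a"], use 2 assms(3-) in simp, fact mem, use 2 assms(3-) in simp)
  next
    case 3
    show ?thesis
      by (rule *[of "c - b - a"], use 3 assms(3-) in simp, fact mem, use 3 assms(3-) in simp)
  next
    case 4
    show ?thesis
      by (rule *[of "c + b - a"], use 4 assms(3-) in simp, fact mem, use 4 assms(3-) in simp)
  next
    case 5
    show ?thesis
      by (rule *[of "d + b + a"], use 5 assms(3-) in simp, fact mem, use 5 assms(3-) in simp)
  qed
qed

text \<open>
  If \<open>a, b, c\<close> is a progression, then \<open>b - a = c - b\<close> and two of the eight sums used in the other case
  are lost.  The sum \<open>d + b + a\<close> replaces one of them: it could only equal \<open>d + c - a\<close>, and this
  would mean \<open>b = 3 * a\<close>.  Two more sums are needed.  One is \<open>d - b - a\<close> up to sign, and the other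
  is \<open>c - b - a\<close> up to sign, with exceptions in two families.
\<close>

lemma card_ge_17_if_progression:
  fixes a b c d :: int
  assumes "finite A" "{a, b, c, d} \<subseteq> A" "0 < a" "a < b" "b < c" "c < d"
    and "c = 2 * b - a" "b \<noteq> 3 * a"
  shows "17 \<le> card (restricted_signed_sumset 3 A)"
proof -
  note mem = signed_sums_of_four[OF assms(1,2,4,5,6)]
  let ?T = "\<lambda>v w. [d + c + b, d + c + a, d + c - a, d + c - b, d + b + a,
    d - c + b, d - c + a, v, w]"
  have *: ?thesis if "distinct (?T v w)" "v \<in> restricted_signed_sumset 3 A"
    "w \<in> restricted_signed_sumset 3 A" "v \<ge> 0" "w \<ge> 0"
    for v w
  proof -
    have "set (?T v w) \<subseteq> restricted_signed_sumset 3 A"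
      using that(2,3) mem by simp
    moreover have "\<forall>y\<in>set (?T v w). 0 \<le> y"
      using that(4,5) assms(3-) by simp
    ultimately show ?thesis
      using card_ge_of_nonneg_sums(1)[OF assms(1) that(1)] by simp
  qed
  \<comment> \<open>If \<open>d \<le> a + b\<close>, then \<open>b < 2 * a\<close>, since \<open>2 * b - a = c < d\<close>.  The exceptions \<open>d = 3 * a\<close> and
    \<open>d = 3 * b - 4 * a\<close> are the cases in which \<open>\<bar>c - b - a\<bar> = \<bar>b - 2 * a\<bar>\<close> equals \<open>d - b - a\<close> or
    \<open>d - c + a\<close>.\<close>
  consider "d \<le> a + b" | "d > a + b" "b \<le> 2 * a" "d = 3 * a"
    | "d > a + b" "b \<le> 2 * a" "d \<noteq> 3 * a"
    | "d > a + b" "b > 2 * a" "d = 3 * b - 4 * a"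
    | "d > a + b" "b > 2 * a" "d \<noteq> 3 * b - 4 * a"
    by linarith
  then show ?thesis
  proof cases
    case 1
    show ?thesis
      by (rule *[of "- d + b + a" "- c + b + a"], use 1 assms(3-) in simp, fact mem, fact mem,
          use 1 assms(3-) in simp, use 1 assms(3-) in simp)
  next
    case 2
    show ?thesis
      by (rule *[of "d - b - a" "c + b + a"], use 2 assms(3-) in simp, fact mem, fact mem,
          use 2 assms(3-) in simp, use 2 assms(3-) in simp)
  next
    case 3
    show ?thesis
      by (rule *[of "d - b - a" "- c + b + a"], use 3 assms(3-) in simp, fact mem, fact mem,
          use 3 assms(3-) in simp, use 3 assms(3-) in simp)
  next
    case 4
    show ?thesis
      by (rule *[of "d - b - a" "c + b - a"], use 4 assms(3-) in simp, fact mem, fact mem,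
          use 4 assms(3-) in simp, use 4 assms(3-) in simp)
  next
    case 5
    show ?thesis
      by (rule *[of "d - b - a" "c - b - a"], use 5 assms(3-) in simp, fact mem, fact mem,
          use 5 assms(3-) in simp, use 5 assms(3-) in simp)
  qed
qed

text \<open>
  Here the positive sums are \<open>d\<close> plus \<open>8 * a\<close>, \<open>6 * a\<close>, \<open>4 * a\<close>, \<open>2 * a\<close>, \<open>-2 * a\<close> and \<open>-4 * a\<close>, all
  greater than \<open>a\<close>, together with \<open>a\<close> and \<open>3 * a\<close>.  As \<open>d > 5 * a\<close>, the sum \<open>d - 4 * a\<close> is \<open>3 * a\<close> only
  for \<open>d = 7 * a\<close>.  The ninth sum is \<open>\<bar>d - 6 * a\<bar>\<close>, except that this is also \<open>3 * a\<close> for \<open>d = 9 * a\<close>.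
\<close>

lemma card_ge_17_if_1_3_5:
  fixes a b c d :: int
  assumes "finite A" "{a, b, c, d} \<subseteq> A" "0 < a" "a < b" "b < c" "c < d"
    and "b = 3 * a" "c = 5 * a" "d \<noteq> 7 * a"
  shows "17 \<le> card (restricted_signed_sumset 3 A)"
proof -
  note mem = signed_sums_of_four[OF assms(1,2,4,5,6)]
  let ?T = "\<lambda>v. [d + c + b, d + c + a, d + b + a, d + c - b, d - c + b, d - b - a,
    c - b + a, c - b - a, v]"
  have *: ?thesis if "distinct (?T v)" "v \<in> restricted_signed_sumset 3 A" "v \<ge> 0"
    for v
  proof -
    have "set (?T v) \<subseteq> restricted_signed_sumset 3 A"
      using that(2) mem by simp
    moreover have "\<forall>y\<in>set (?T v). 0 \<le> y"
      using that(3) assms(3-) by simp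
    ultimately show ?thesis
      using card_ge_of_nonneg_sums(1)[OF assms(1) that(1)] by simp
  qed
  consider "d \<le> 6 * a" | "d = 9 * a" | "d > 6 * a" "d \<noteq> 9 * a"
    by linarith
  then show ?thesis
  proof cases
    case 1
    show ?thesis
      by (rule *[of "- d + c + a"], use 1 assms(3-) in simp, fact mem, use 1 assms(3-) in simp)
  next
    case 2
    show ?thesis
      by (rule *[of "c + b + a"], use 2 assms(3-) in simp, fact mem, use 2 assms(3-) in simp)
  next
    case 3
    show ?thesis
      by (rule *[of "d - c - a"], use 3 assms(3-) in simp, fact mem, use 3 assms(3-) in simp)
  qed
qed

lemma four_largest_elements:
  fixes A :: "int set"
  assumes "finite A" "card A \<ge> 4"
  shows "\<exists>x p q r. {x, p, q, r} \<subseteq> A \<and> r < q \<and> q < p \<and> p < x \<and>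
    (\<forall>y\<in>A. y \<in> {x, p, q, r} \<or> y < r)"
proof -
  have top: "\<exists>m\<in>B. \<forall>y\<in>B - {m}. y < m" if "B \<subseteq> A" "card B > 0" for B
  proof -
    have "finite B" "B \<noteq> {}"
      using that assms(1) finite_subset by auto
    then show ?thesis
      using Max_in[of B] Max_ge[of B] by (intro bexI[of _ "Max B"]) (auto simp: less_le)
  qed
  obtain x where x: "x \<in> A" "\<forall>y\<in>A - {x}. y < x"
    using top[of A] assms(2) by auto
  obtain p where p: "p \<in> A - {x}" "\<forall>y\<in>A - {x} - {p}. y < p"
    using top[of "A - {x}"] assms x by auto
  obtain q where q: "q \<in> A - {x} - {p}" "\<forall>y\<in>A - {x} - {p} - {q}. y < q"
    using top[of "A - {x} - {p}"] assms x p by auto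
  obtain r where r: "r \<in> A - {x} - {p} - {q}" "\<forall>y\<in>A - {x} - {p} - {q} - {r}. y < r"
    using top[of "A - {x} - {p} - {q}"] assms x p q by auto
  show ?thesis
    by (rule exI[of _ x], rule exI[of _ p], rule exI[of _ q], rule exI[of _ r])
      (use x p q r in auto)
qed

lemma four_elements:
  fixes A :: "int set"
  assumes "card A = 4" "\<forall>a\<in>A. a > 0"
  shows "16 \<le> card (restricted_signed_sumset 3 A)"
    and "card (restricted_signed_sumset 3 A) = 16 \<Longrightarrow> \<exists>a>0. A = {a, 3 * a, 5 * a, 7 * a}"
proof -
  have fin: "finite A"
    using assms(1) card.infinite by fastforce
  obtain a b c d where A: "{a, b, c, d} \<subseteq> A" "a < b" "b < c" "c < d"
    using four_largest_elements[OF fin] assms(1) by auto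
  have eq: "A = {a, b, c, d}"
    using A assms(1) fin by (intro card_subset_eq[symmetric]) auto
  have pos: "a > 0"
    using A assms(2) by auto
  note facts = fin A(1) pos A(2-)
  note mem = signed_sums_of_four[OF fin A]
  have *: "17 \<le> card (restricted_signed_sumset 3 A) \<or> b = 3 * a \<and> c = 5 * a \<and> d = 7 * a"
  proof (cases "c = 2 * b - a \<and> b = 3 * a")
    case True
    then show ?thesis
      using card_ge_17_if_1_3_5[OF facts] by auto
  next
    case False
    then show ?thesis
      using card_ge_17_if_no_progression[OF facts] card_ge_17_if_progression[OF facts] by auto
  qed
  show "16 \<le> card (restricted_signed_sumset 3 A)"
  proof (cases "b = 3 * a \<and> c = 5 * a \<and> d = 7 * a")
    case True
    \<comment> \<open>None of these eight sums is 0, so the mirror image doubles their number.\<close>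
    let ?T = "[a, 3 * a, 5 * a, 7 * a, 9 * a, 11 * a, 13 * a, 15 * a]"
    have "set ?T \<subseteq> restricted_signed_sumset 3 A"
      using mem True by simp
    then show ?thesis
      using card_ge_of_nonneg_sums(2)[OF fin, of ?T] pos by simp
  next
    case False
    then show ?thesis
      using * by linarith
  qed
  show "\<exists>a>0. A = {a, 3 * a, 5 * a, 7 * a}" if "card (restricted_signed_sumset 3 A) = 16"
    using * that pos eq by auto
qed

section \<open>Adding a new largest element\<close>

lemma signed_triple_le:
  fixes B :: "int set"
  assumes "finite B" "\<forall>b\<in>B. b > 0" "r < q" "q < p" "\<forall>y\<in>B. y \<in> {p, q, r} \<or> y < r"
    and "v \<in> restricted_signed_sumset 3 B"
  shows "v \<le> p + q + r"
proof -
  obtain x y z s t u where xyz: "{x, y, z} \<subseteq> B" "x \<noteq> y" "x \<noteq> z" "y \<noteq> z"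
    and st: "{s, t, u} \<subseteq> {-1, 1}" and v: "v = s * x + t * y + u * z"
    by (rule restricted_signed_sumset_3E[OF assms(1,6)])
  have pos: "x > 0" "y > 0" "z > 0"
    using xyz assms(2) by auto
  have "s * x \<le> x" "t * y \<le> y" "u * z \<le> z"
    using pos st by auto
  then have "v \<le> x + y + z"
    using v by linarith
  also have "\<dots> \<le> p + q + r"
  proof -
    have "x \<in> {p, q, r} \<or> x < r" "y \<in> {p, q, r} \<or> y < r" "z \<in> {p, q, r} \<or> z < r"
      using xyz assms(5) by auto
    then show ?thesis
      using xyz(2-) assms(3,4) by auto
  qed
  finally show ?thesis .
qed

text \<open>
  The six new sums are \<open>x + p + q\<close>, \<open>x + p + r\<close>, \<open>x + q + r\<close> and their negatives, which lie outside
  the interval from \<open>- (p + q + r)\<close> to \<open>p + q + r\<close> that contains the old sums.  When there are no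
  other new sums, every sum strictly between 0 and \<open>x + q + r\<close> is an old one.
\<close>

lemma insert_larger_element:
  fixes B :: "int set"
  assumes "finite B" "\<forall>b\<in>B. b > 0" "{p, q, r} \<subseteq> B" "r < q" "q < p" "p < x"
    and "\<forall>y\<in>B. y \<in> {p, q, r} \<or> y < r"
  defines "S \<equiv> restricted_signed_sumset 3 (insert x B)"
    and "S' \<equiv> restricted_signed_sumset 3 B"
  shows "card S \<ge> card S' + 6"
    and "\<lbrakk>card S = card S' + 6; v \<in> S; 0 < v; v < x + q + r\<rbrakk> \<Longrightarrow> v \<in> S'"
proof -
  define N where "N = {x + p + q, x + p + r, x + q + r}"
  have fin: "finite S" "finite S'"
    unfolding S_def S'_def using assms(1) by (auto intro: finite_restricted_signed_sumset_3)
  have old: "v \<le> p + q + r" "- v \<le> p + q + r" if "v \<in> S'" for v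
    using signed_triple_le[OF assms(1,2,4,5,7)] that uminus_mem_restricted_signed_sumset
    unfolding S'_def by blast+
  have pos: "r > 0"
    using assms(2,3) by auto
  have N: "v > p + q + r" "v > 0" if "v \<in> N" for v
    using that pos assms(4-6) by (auto simp: N_def)
  have "v \<notin> S'" "- v \<notin> S'" "- v \<notin> N" if "v \<in> N" for v
    using old[of v] old[of "- v"] N[OF that] N[of "- v"] by auto
  then have disj: "S' \<inter> (N \<union> uminus ` N) = {}" "N \<inter> uminus ` N = {}"
    by auto
  have "card N = 3"
    using assms(4-6) by (simp add: N_def)
  moreover have "finite N"
    by (simp add: N_def)
  ultimately have card: "card (S' \<union> (N \<union> uminus ` N)) = card S' + 6"
    using disj fin by (simp add: card_Un_disjoint card_image)
  have "x + p + q \<in> S" "x + p + r \<in> S" "x + q + r \<in> S"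
    unfolding S_def using assms(1,3-6)
    by (intro signed_triples_mem(1); simp)+
  then have "N \<subseteq> S"
    by (simp add: N_def)
  moreover have "S' \<subseteq> S"
    unfolding S_def S'_def using assms(1) by (intro restricted_signed_sumset_3_mono) auto
  ultimately have sub: "S' \<union> (N \<union> uminus ` N) \<subseteq> S"
    using uminus_mem_restricted_signed_sumset unfolding S_def by blast
  show "card S \<ge> card S' + 6"
    using card_mono[OF fin(1) sub] card by simp
  assume "card S = card S' + 6" and v: "v \<in> S" "0 < v" "v < x + q + r"
  then have "S' \<union> (N \<union> uminus ` N) = S"
    using card_subset_eq[OF fin(1) sub] card by simp
  moreover have "v \<notin> N" "v \<notin> uminus ` N"
    using v N assms(4-6) by (auto simp: N_def)
  ultimately show "v \<in> S'"
    using v by blast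
qed

section \<open>Dilations of the odd numbers\<close>

lemma mem_dilation_first_odds:
  "v \<in> dilation d (first_odds k) \<longleftrightarrow> (\<exists>i. 1 \<le> i \<and> i \<le> k \<and> v = d * (2 * int i - 1))"
  by (auto simp: dilation_def first_odds_def)

lemma dilation_first_odds_Suc:
  "dilation d (first_odds (Suc k)) = insert (d * (2 * int k + 1)) (dilation d (first_odds k))"
proof -
  have "{1..Suc k} = insert (Suc k) {1..k}"
    by auto
  moreover have "first_odds n = (\<lambda>i. 2 * int i - 1) ` {1..n}" for n
    unfolding first_odds_def by auto
  ultimately show ?thesis
    by (simp add: dilation_def add.commute)
qed

text \<open>A signed sum of an odd number of odd multiples of \<open>d\<close> is again an odd multiple of \<open>d\<close>.\<close>

lemma signed_triple_dilation_first_odds: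
  assumes "v \<in> restricted_signed_sumset 3 (dilation d (first_odds k))"
  shows "\<exists>m. v = d * (2 * m + 1)"
proof -
  have "finite (first_odds k)"
    unfolding first_odds_def by (rule finite_subset[of _ "(\<lambda>i. 2 * int i - 1) ` {1..k}"]) auto
  then have "finite (dilation d (first_odds k))"
    by (simp add: dilation_def)
  then obtain x y z s t u where "{x, y, z} \<subseteq> dilation d (first_odds k)"
    and st: "{s, t, u} \<subseteq> {-1, 1}" and v: "v = s * x + t * y + u * z"
    using restricted_signed_sumset_3E[OF _ assms] by metis
  then obtain i j l where xyz: "x = d * (2 * i - 1)" "y = d * (2 * j - 1)" "z = d * (2 * l - 1)"
    by (auto simp: mem_dilation_first_odds)
  have "v = d * (s * (2 * i - 1) + t * (2 * j - 1) + u * (2 * l - 1))"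
    unfolding v xyz by (simp add: algebra_simps)
  moreover have "odd (s * (2 * i - 1) + t * (2 * j - 1) + u * (2 * l - 1))"
    using st by auto
  ultimately show ?thesis
    by (metis oddE)
qed

lemma top_of_dilation_first_odds:
  assumes "d > 0" "k \<ge> 4" and B: "B = dilation d (first_odds k)"
    and "{p, q, r} \<subseteq> B" "r < q" "q < p" "\<forall>y\<in>B. y \<in> {p, q, r} \<or> y < r"
  shows "p = d * (2 * int k - 1)" "q = d * (2 * int k - 3)" "r = d * (2 * int k - 5)"
proof -
  \<comment> \<open>\<open>e j\<close> is the element of rank \<open>j\<close> from the top, so the ranks of \<open>p\<close>, \<open>q\<close>, \<open>r\<close> must be 0, 1, 2.\<close>
  define e where "e j = d * (2 * int (k - j) - 1)" for j
  have e: "e j \<in> B" if "j < 4" for j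
    unfolding B mem_dilation_first_odds e_def using that assms(2)
    by (intro exI[of _ "k - j"]) auto
  have "\<exists>j<k. v = e j" if mem: "v \<in> B" for v
  proof -
    obtain i where "1 \<le> i" "i \<le> k" "v = d * (2 * int i - 1)"
      using mem unfolding B mem_dilation_first_odds by (elim exE conjE)
    then show ?thesis
      by (intro exI[of _ "k - i"]) (auto simp: e_def)
  qed
  then obtain i j l where ijl: "i < k" "j < k" "l < k" "p = e i" "q = e j" "r = e l"
    using assms(4) by (meson insert_subset)
  have less: "e i < e j \<longleftrightarrow> j < i" if "i < k" "j < k" for i j
    using that assms(1) by (auto simp: e_def)
  have eq: "e i = e j \<longleftrightarrow> j = i" if "i < k" "j < k" for i j
    using that less by (metis nat_neq_iff less_irrefl)
  have "e n \<in> {e i, e j, e l} \<or> e n < e l" if "n < 4" for n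
    using assms(7) e[OF that] ijl by auto
  then have "n \<in> {i, j, l} \<or> l < n" if "n < 4" for n
    using that eq less ijl assms(2) by auto
  from this[of 0] this[of 1] this[of 2] have "i = 0" "j = 1" "l = 2"
    using less ijl assms(5,6) by auto
  then show "p = d * (2 * int k - 1)" "q = d * (2 * int k - 3)" "r = d * (2 * int k - 5)"
    using ijl assms(2) by (auto simp: e_def of_nat_diff)
qed

text \<open>
  The sum \<open>x + q + s\<close>, where \<open>s\<close> is the fourth largest element of \<open>B\<close>, is too small to be one of the
  new sums.  The sum \<open>x + p + s\<close> could not be used in its place: it equals the new sum \<open>x + q + r\<close>.
\<close>

lemma extremal_new_element:
  assumes "d > 0" "k \<ge> 4" and B: "B = dilation d (first_odds k)"
    and top: "{p, q, r} \<subseteq> B" "r < q" "q < p" "p < x" "\<forall>y\<in>B. y \<in> {p, q, r} \<or> y < r"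
    and "finite B" "\<forall>b\<in>B. b > 0"
    and card: "card (restricted_signed_sumset 3 (insert x B)) = card (restricted_signed_sumset 3 B) + 6"
  shows "x = d * (2 * int k + 1)"
proof -
  note pqr = top_of_dilation_first_odds[OF assms(1,2) B top(1-3,5)]
  define s where "s = d * (2 * int k - 7)"
  have s: "s \<in> B"
    unfolding B mem_dilation_first_odds s_def using assms(2)
    by (intro exI[of _ "k - 3"]) (auto simp: of_nat_diff)
  have sr: "s < r"
    using assms(1) by (simp add: s_def pqr)
  have "s > 0"
    using s assms(10) by auto
  have "x + q + s \<in> restricted_signed_sumset 3 (insert x B)"
    using signed_triples_mem(1)[of "insert x B" s q x] s sr top assms(9) by auto
  then have mem: "x + q + s \<in> restricted_signed_sumset 3 B"
    using insert_larger_element(2)[OF assms(9,10) top card] \<open>s > 0\<close> sr top by auto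
  have "x + q + s \<le> p + q + r"
    using signed_triple_le[OF assms(9,10) top(2,3,5) mem] .
  then have le: "x \<le> d * (2 * int k + 1)"
    by (simp add: pqr s_def algebra_simps)
  obtain m where "x + q + s = d * (2 * m + 1)"
    using signed_triple_dilation_first_odds mem B by blast
  then have x: "x = d * (2 * (m - 2 * int k + 5) + 1)"
    by (simp add: pqr s_def algebra_simps)
  have "d * (2 * int k - 1) < d * (2 * (m - 2 * int k + 5) + 1)"
    using top(4) x pqr by simp
  then have "int k \<le> m - 2 * int k + 5"
    using assms(1) by simp
  moreover have "m - 2 * int k + 5 \<le> int k"
    using le assms(1) unfolding x by simp
  ultimately show ?thesis
    using x by simp
qed

theorem theorem2p4:
  fixes k :: nat and A :: "int set"
  assumes "k \<ge> 4"
    and "finite A" and "card A = k" and "\<forall>a\<in>A. a > 0"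
  shows "card (restricted_signed_sumset 3 A) \<ge> 6 * k - 8 \<and>
    (card (restricted_signed_sumset 3 A) = 6 * k - 8 \<longrightarrow>
      (\<exists>d>0. A = dilation d (first_odds k)))"
  using assms
proof (induction k arbitrary: A rule: dec_induct)
  case base
  have "dilation d (first_odds 4) = {d, 3 * d, 5 * d, 7 * d}" for d
    by (auto simp: dilation_first_odds_Suc numeral_eq_Suc dilation_def first_odds_def)
  then show ?case
    using four_elements[of A] base by simp
next
  case (step k)
  obtain x p q r where top: "{x, p, q, r} \<subseteq> A" "r < q" "q < p" "p < x"
    "\<forall>y\<in>A. y \<in> {x, p, q, r} \<or> y < r"
    using four_largest_elements[of A] step by auto
  define B where "B = A - {x}"
  have A: "A = insert x B"
    using top by (auto simp: B_def)
  have B: "finite B" "\<forall>b\<in>B. b > 0" "card B = k" "{p, q, r} \<subseteq> B"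
    "\<forall>y\<in>B. y \<in> {p, q, r} \<or> y < r"
    using step.prems top by (auto simp: B_def)
  let ?S = "restricted_signed_sumset 3"
  have IH: "6 * k - 8 \<le> card (?S B)"
    "card (?S B) = 6 * k - 8 \<Longrightarrow> \<exists>d>0. B = dilation d (first_odds k)"
    using step.IH[of B] B by auto
  have grow: "card (?S B) + 6 \<le> card (?S A)"
    unfolding A using insert_larger_element(1)[OF B(1,2,4) top(2-4) B(5)] .
  have "\<exists>d>0. A = dilation d (first_odds (Suc k))" if "card (?S A) = 6 * Suc k - 8"
  proof -
    have card: "card (?S B) = 6 * k - 8" "card (?S (insert x B)) = card (?S B) + 6"
      using that IH(1) grow step.hyps unfolding A by auto
    then obtain d where d: "d > 0" "B = dilation d (first_odds k)"
      using IH(2) by blast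
    have "x = d * (2 * int k + 1)"
      using extremal_new_element[OF d(1) step.hyps(1) d(2) B(4) top(2-4) B(5) B(1,2) card(2)] .
    then show ?thesis
      using d A by (auto simp: dilation_first_odds_Suc)
  qed
  then show ?case
    using IH(1) grow step.hyps by auto
qed

end
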